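(* Let $G$ be a finite connected simple graph, let $\kappa(G)$ be its vertex connectivity, and let $s(G)$ be the minimum number of branch vertices in a spanning tree of $G$. If $s(G) \le \kappa(G)$, then $G$ has a spanning generalized caterpillar.
   Context: Graphs are finite, connected, without loops or multiple edges. A branch vertex of a tree $T$ is a vertex $v$ with $d_T(v) > 2$, where $d_T(v)$ is the degree of $v$ in $T$. The number $s(G)$ is the minimum, over all spanning trees $T$ of $G$, of the number of branch vertices of $T$. A generalized caterpillar is a tree $T$ in which all vertices of degree more than two lie on a common path of $T$. A spanning generalized caterpillar of $G$ is a spanning tree of $G$ that is a generalized caterpillar. $\kappa(G)$ is the usual vertex connectivity number (with $\kappa(K_n) = n-1$). *)

theory Defs
  imports "Graph_Theory.Graph_Theory"
begin

text \<open>
  A finite simple graph is a \<^locale>\<open>pair_graph\<close>: a finite vertex set with a symmetric, irreflexive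
  set of ordered pairs, each undirected edge being represented by its two orientations. The degree
  of a vertex is therefore its out-degree.

  The library predicates \<^const>\<open>tree\<close> and \<^const>\<open>spanning_tree\<close> refer to directed cycles. They
  are unsuitable for symmetric digraphs, where the two orientations of an edge already form a cycle
  of length two; they also accept acyclic orientations of undirected cycles. Here a cycle of
  an undirected graph is a cycle of length at least three in its symmetric digraph.
\<close>

definition undirected_tree :: "'a pair_pre_digraph \<Rightarrow> bool" where
  "undirected_tree T \<longleftrightarrow>
     pair_graph T \<and> connected (with_proj T) \<and>
     \<not> (\<exists>p. pre_digraph.cycle (with_proj T) p \<and> 3 \<le> length p)"

definition undirected_spanning_tree :: "'a pair_pre_digraph \<Rightarrow> 'a pair_pre_digraph \<Rightarrow> bool" where
  "undirected_spanning_tree T G \<longleftrightarrow> undirected_tree T \<and> spanning (with_proj T) (with_proj G)"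

definition branch_vertices :: "'a pair_pre_digraph \<Rightarrow> 'a set" where
  "branch_vertices T = {v \<in> pverts T. out_degree (with_proj T) v > 2}"

definition min_branch_vertices :: "'a pair_pre_digraph \<Rightarrow> nat" where
  "min_branch_vertices G =
     (LEAST n. \<exists>T. undirected_spanning_tree T G \<and> n = card (branch_vertices T))"

definition generalized_caterpillar :: "'a pair_pre_digraph \<Rightarrow> bool" where
  "generalized_caterpillar T \<longleftrightarrow>
     undirected_tree T \<and> (\<exists>p. vpath p (with_proj T) \<and> branch_vertices T \<subseteq> set p)"

definition spanning_generalized_caterpillar ::
    "'a pair_pre_digraph \<Rightarrow> 'a pair_pre_digraph \<Rightarrow> bool" where
  "spanning_generalized_caterpillar T G \<longleftrightarrow>
     undirected_spanning_tree T G \<and> generalized_caterpillar T"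

definition complete_graph :: "'a pair_pre_digraph \<Rightarrow> bool" where
  "complete_graph G \<longleftrightarrow> (\<forall>u\<in>pverts G. \<forall>v\<in>pverts G. u \<noteq> v \<longrightarrow> (u, v) \<in> parcs G)"

text \<open>
  Separating sets are required to be proper subsets of the vertex set because the empty graph does
  not satisfy \<^const>\<open>connected\<close>.
\<close>

definition vertex_connectivity :: "'a pair_pre_digraph \<Rightarrow> nat" where
  "vertex_connectivity G =
     (if complete_graph G then card (pverts G) - 1
      else (LEAST k. \<exists>S. S \<subset> pverts G \<and> \<not> connected (with_proj G \<restriction> (pverts G - S)) \<and> k = card S))"

end

theory Submission
  imports Defs
begin

text \<open>
  Let \<open>B\<close> be the set of branch vertices of an optimal spanning tree \<open>T\<close>. Since \<open>B\<close> has at most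
  \<open>\<kappa>(G)\<close> vertices, some path \<open>P\<close> of \<open>G\<close> contains \<open>B\<close>. Extend \<open>P\<close> to a spanning tree of
  \<open>T \<union> P\<close>: a vertex off \<open>P\<close> has the same neighbours in \<open>T \<union> P\<close> as in \<open>T\<close> and is not in \<open>B\<close>, so it
  is not a branch vertex of the new tree.

  The path is a variant of Dirac's theorem on cycles through given vertices: a vertex \<open>v\<close> is added
  to a path containing fewer than \<open>k\<close> prescribed vertices by means of a fan from \<open>v\<close> to that path. The
  fan lemma is derived from Hall's theorem instead of Menger's.
\<close>

section \<open>Fans\<close>

text \<open>Induction on the size of the family. If a proper nonempty subfamily \<open>J\<close> is
  tight, \<open>J\<close> and its complement are matched separately, the complement avoiding the
  union \<open>U\<close> of \<open>J\<close>. Otherwise every such subfamily has an element to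
  spare, so some \<open>i\<close> can be given any \<open>x\<close> of \<open>A i\<close> and
  \<open>x\<close> removed elsewhere.\<close>

lemma hall_marriage:
  fixes A :: "'i \<Rightarrow> 'b set"
  assumes "finite I" "\<And>i. i \<in> I \<Longrightarrow> finite (A i)"
    and "\<And>J. J \<subseteq> I \<Longrightarrow> card J \<le> card (\<Union>(A ` J))"
  shows "\<exists>f. inj_on f I \<and> (\<forall>i\<in>I. f i \<in> A i)"
  using assms
proof (induction "card I" arbitrary: I A rule: less_induct)
  case less
  note fin = less.prems(1,2) and hall = less.prems(3)
  show ?case
  proof (cases "I = {}")
    case False
    then obtain i where i: "i \<in> I" by blast
    show ?thesis
    proof (cases "\<exists>J. J \<noteq> {} \<and> J \<subset> I \<and> card (\<Union>(A ` J)) \<le> card J")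
      case True
      then obtain J where J: "J \<noteq> {}" "J \<subset> I" "card (\<Union>(A ` J)) \<le> card J" by blast
      define U where "U = \<Union>(A ` J)"
      have finJ: "finite J" using J fin finite_subset by blast
      have finU: "finite U" unfolding U_def using J fin finJ by blast
      have "card J < card I" using J fin by (simp add: psubset_card_mono)
      then obtain f where f: "inj_on f J" "\<forall>i\<in>J. f i \<in> A i"
        using less.hyps[of J A] J fin hall finJ by (metis psubset_imp_subset subset_iff subset_trans)
      have "card (I - J) < card I"
        using J fin by (intro psubset_card_mono) auto
      \<comment> \<open>\<open>K\<close> and \<open>J\<close> together see at least
        \<open>card K + card J\<close> elements, and at most \<open>card J\<close> of them lie in
        \<open>U\<close>.\<close>
      moreover have "card K \<le> card (\<Union>((\<lambda>i. A i - U) ` K))" if K: "K \<subseteq> I - J" for K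
      proof -
        have finK: "finite K" using K fin finite_subset by blast
        have "card K + card J = card (K \<union> J)"
          using K finK finJ by (subst card_Un_disjoint) auto
        also have "\<dots> \<le> card (\<Union>(A ` (K \<union> J)))" using hall[of "K \<union> J"] K J by blast
        also have "\<Union>(A ` (K \<union> J)) = \<Union>((\<lambda>i. A i - U) ` K) \<union> U" unfolding U_def by blast
        also have "card \<dots> \<le> card (\<Union>((\<lambda>i. A i - U) ` K)) + card U" by (rule card_Un_le)
        finally show ?thesis using J unfolding U_def by linarith
      qed
      ultimately obtain g where g: "inj_on g (I - J)" "\<forall>i\<in>I - J. g i \<in> A i - U"
        using less.hyps[of "I - J" "\<lambda>i. A i - U"] fin by fastforce
      have "f i \<in> U" if "i \<in> J" for i using f(2) that unfolding U_def by blast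
      then have "f i \<noteq> g j" if "i \<in> J" "j \<in> I - J" for i j
        using bspec[OF g(2) that(2)] that(1) by (metis DiffD2)
      then have "inj_on (\<lambda>i. if i \<in> J then f i else g i) I"
        using inj_onD[OF f(1)] inj_onD[OF g(1)]
        by (intro inj_onI) (metis (full_types) DiffI)
      moreover have "\<forall>i\<in>I. (if i \<in> J then f i else g i) \<in> A i" using f g by auto
      ultimately show ?thesis by blast
    next
      case nocrit: False
      have "A i \<noteq> {}" using hall[of "{i}"] i by auto
      then obtain x where x: "x \<in> A i" by blast
      have "card (I - {i}) < card I"
        using i fin by (intro psubset_card_mono) auto
      moreover have "card K \<le> card (\<Union>((\<lambda>j. A j - {x}) ` K))" if K: "K \<subseteq> I - {i}" for K
      proof (cases "K = {}")
        case False
        then have "card K < card (\<Union>(A ` K))"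
          using nocrit K i by (metis Diff_subset not_le psubsetI subset_Diff_insert subset_trans)
        moreover have "\<Union>((\<lambda>j. A j - {x}) ` K) = \<Union>(A ` K) - {x}" by blast
        ultimately show ?thesis by (auto simp: card_Diff_singleton_if)
      qed simp
      ultimately obtain g where g: "inj_on g (I - {i})" "\<forall>j\<in>I - {i}. g j \<in> A j - {x}"
        using less.hyps[of "I - {i}" "\<lambda>j. A j - {x}"] fin by fastforce
      have "inj_on (g(i := x)) I" using g by (auto simp: inj_on_def)
      moreover have "\<forall>j\<in>I. (g(i := x)) j \<in> A j" using g x by auto
      ultimately show ?thesis by blast
    qed
  qed simp
qed

text \<open>
  A set \<open>W\<close> with a non-neighbour is separated from it by its neighbourhood, so the number of vertices
  needed to separate the graph is at least \<open>k\<close>. Complete graphs satisfy this for every \<open>k\<close>.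
\<close>

definition k_connected :: "'a set \<Rightarrow> 'a rel \<Rightarrow> nat \<Rightarrow> bool" where
  "k_connected V E k \<longleftrightarrow> (\<forall>W\<subseteq>V. W \<noteq> {} \<longrightarrow> W \<union> E `` W \<noteq> V \<longrightarrow> k \<le> card (E `` W - W))"

text \<open>The empty list is allowed, unlike in \<open>vpath\<close>; it starts the induction in
  \<open>path_through\<close>.\<close>

definition simple_path :: "'a rel \<Rightarrow> 'a list \<Rightarrow> bool" where
  "simple_path E p \<longleftrightarrow> distinct p \<and> successively (\<lambda>x y. (x, y) \<in> E) p"

text \<open>
  Hall's theorem is applied to \<open>K\<close> copies of \<open>v\<close>, to be matched to neighbours of \<open>v\<close>, and to every
  vertex \<open>u\<close> outside \<open>X\<close>, to be matched to itself or to a neighbour. A family containing a copy of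
  \<open>v\<close> and the vertices \<open>U\<close> sees \<open>U\<close> and the neighbourhood of \<open>U \<union> {v}\<close>, which separates \<open>v\<close> from
  \<open>X\<close> or contains \<open>X\<close>.
\<close>

lemma fan_matching:
  assumes "finite V" "E \<subseteq> V \<times> V" "irrefl E" "k_connected V E k"
    and "v \<in> V" "X \<subseteq> V" "v \<notin> X" "K \<le> k" "K \<le> card X"
  obtains s g where "inj_on s {..<K}" "inj_on g (V - X - {v})"
    "\<And>i. i < K \<Longrightarrow> (v, s i) \<in> E"
    "\<And>i u. i < K \<Longrightarrow> u \<in> V - X - {v} \<Longrightarrow> s i \<noteq> g u"
    "\<And>u. u \<in> V - X - {v} \<Longrightarrow> g u = u \<or> (u, g u) \<in> E"
    "s ` {..<K} \<subseteq> V - {v}" "g ` (V - X - {v}) \<subseteq> V - {v}"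
proof -
  define M where "M = V - X - {v}"
  define I where "I = Inl ` {..<K} \<union> Inr ` M"
  \<comment> \<open>Matching \<open>u\<close> to itself allows the fan to avoid \<open>u\<close>.
    Barring \<open>v\<close> as a partner keeps the orbits from returning to
    \<open>v\<close>.\<close>
  define A where "A = (\<lambda>z. case z of Inl (i::nat) \<Rightarrow> E `` {v} | Inr u \<Rightarrow> insert u (E `` {u}) - {v})"
  have finM: "finite M" unfolding M_def using assms by simp
  have finI: "finite I" unfolding I_def using finM by simp
  have irr: "(x, x) \<notin> E" for x using assms(3) by (auto simp: irrefl_def)
  have A_sub: "A z \<subseteq> V - {v}" if "z \<in> I" for z
    using that assms(2) irr unfolding I_def A_def M_def by auto
  have finA: "finite (A z)" if "z \<in> I" for z
    using A_sub[OF that] assms(1) by (meson finite_Diff finite_subset)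
  have hall: "card J \<le> card (\<Union>(A ` J))" if J: "J \<subseteq> I" for J
  proof -
    define U where "U = {u. Inr u \<in> J}"
    have UM: "U \<subseteq> M" using J unfolding U_def I_def by auto
    have finU: "finite U" using UM finM finite_subset by blast
    have finN: "finite (\<Union>(A ` J))" using J finI finA by (meson finite_UN_I finite_subset subsetD)
    have U_sub: "U \<subseteq> \<Union>(A ` J)" using UM unfolding U_def A_def M_def by force
    show ?thesis
    proof (cases "\<exists>i. Inl i \<in> J")
      case False
      then have "J = Inr ` U" unfolding U_def by (auto; metis sum.exhaust image_eqI mem_Collect_eq)
      then have "card J = card U" by (simp add: card_image)
      then show ?thesis using card_mono[OF finN U_sub] by simp
    next
      case True
      define W where "W = insert v U"
      have W: "W \<subseteq> V" "W \<noteq> {}" "W \<inter> X = {}"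
        using assms UM unfolding W_def M_def by auto
      have finS: "finite (E `` W - W)"
        using finite_subset[OF _ assms(1), of "E `` W"] assms(2) by blast
      have "K \<le> card (E `` W - W)"
      proof (cases "W \<union> E `` W = V")
        case True
        then have "X \<subseteq> E `` W - W" using assms W by blast
        then have "card X \<le> card (E `` W - W)" by (rule card_mono[OF finS])
        then show ?thesis using assms(9) by simp
      next
        case False
        then show ?thesis using assms(4,8) W unfolding k_connected_def by (meson le_trans)
      qed
      moreover have "card J \<le> K + card U"
      proof -
        have "J \<subseteq> Inl ` {..<K} \<union> Inr ` U" using J unfolding I_def U_def by auto
        then have "card J \<le> card ((Inl ` {..<K} \<union> Inr ` U) :: (nat + 'a) set)"
          using finU by (intro card_mono) auto
        also have "\<dots> \<le> K + card U"
          by (rule order_trans[OF card_Un_le]) (simp add: card_image)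
        finally show ?thesis .
      qed
      moreover have "U \<union> (E `` W - W) \<subseteq> \<Union>(A ` J)"
      proof -
        have "E `` W - W \<subseteq> \<Union>(A ` J)"
        proof
          fix y assume "y \<in> E `` W - W"
          then obtain x where x: "x \<in> W" "(x, y) \<in> E" "y \<noteq> v" unfolding W_def by blast
          show "y \<in> \<Union>(A ` J)"
          proof (cases "x = v")
            case True
            with x \<open>\<exists>i. Inl i \<in> J\<close> show ?thesis unfolding A_def by force
          next
            case False
            with x have "Inr x \<in> J" unfolding W_def U_def by simp
            then show ?thesis using x unfolding A_def by force
          qed
        qed
        with U_sub show ?thesis by blast
      qed
      then have "card (U \<union> (E `` W - W)) \<le> card (\<Union>(A ` J))" using finN by (rule card_mono[rotated])
      moreover have "card (U \<union> (E `` W - W)) = card U + card (E `` W - W)"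
        using finU finS unfolding W_def by (intro card_Un_disjoint) auto
      ultimately show ?thesis by linarith
    qed
  qed
  obtain f where f: "inj_on f I" "\<forall>z\<in>I. f z \<in> A z"
    using hall_marriage[OF finI finA hall] by blast
  show thesis
  proof
    show "inj_on (\<lambda>i. f (Inl i)) {..<K}"
      using f(1) unfolding I_def inj_on_def by blast
    show "inj_on (\<lambda>u. f (Inr u)) (V - X - {v})"
      using f(1) unfolding I_def M_def inj_on_def by blast
    show "(v, f (Inl i)) \<in> E" if "i < K" for i
      using bspec[OF f(2), of "Inl i"] that unfolding I_def A_def by auto
    show "f (Inl i) \<noteq> f (Inr u)" if "i < K" "u \<in> V - X - {v}" for i u
      using f(1) that unfolding I_def M_def inj_on_def by blast
    show "f (Inr u) = u \<or> (u, f (Inr u)) \<in> E" if "u \<in> V - X - {v}" for u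
      using bspec[OF f(2), of "Inr u"] that unfolding I_def M_def A_def by auto
    show "(\<lambda>i. f (Inl i)) ` {..<K} \<subseteq> V - {v}"
    proof (rule image_subsetI)
      fix i assume "i \<in> {..<K}"
      then have "Inl i \<in> I" unfolding I_def by blast
      then show "f (Inl i) \<in> V - {v}" using bspec[OF f(2)] A_sub by blast
    qed
    show "(\<lambda>u. f (Inr u)) ` (V - X - {v}) \<subseteq> V - {v}"
    proof (rule image_subsetI)
      fix u assume "u \<in> V - X - {v}"
      then have "Inr u \<in> I" unfolding I_def M_def by blast
      then show "f (Inr u) \<in> V - {v}" using bspec[OF f(2)] A_sub by blast
    qed
  qed
qed

text \<open>
  The paths of the fan are the orbits of the matching starting at the copies of \<open>v\<close>. By injectivity
  they are disjoint and never return, hence they cannot stay outside \<open>X\<close>.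
\<close>

lemma fan:
  assumes "finite V" "E \<subseteq> V \<times> V" "irrefl E" "k_connected V E k"
    and "v \<in> V" "X \<subseteq> V" "v \<notin> X" "K \<le> k" "K \<le> card X"
  obtains p where "\<And>i. i < K \<Longrightarrow> p i \<noteq> [] \<and> simple_path E (v # p i) \<and> set (p i) \<inter> X = {last (p i)}"
    "\<And>i j. i < K \<Longrightarrow> j < K \<Longrightarrow> i \<noteq> j \<Longrightarrow> set (p i) \<inter> set (p j) = {}"
proof -
  obtain s g where inj_s: "inj_on s {..<K}" and inj_g: "inj_on g (V - X - {v})"
    and vs: "\<And>i. i < K \<Longrightarrow> (v, s i) \<in> E"
    and sg: "\<And>i u. i < K \<Longrightarrow> u \<in> V - X - {v} \<Longrightarrow> s i \<noteq> g u"
    and g: "\<And>u. u \<in> V - X - {v} \<Longrightarrow> g u = u \<or> (u, g u) \<in> E"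
    and s_V: "s ` {..<K} \<subseteq> V - {v}" and g_V: "g ` (V - X - {v}) \<subseteq> V - {v}"
    using fan_matching[OF assms] by blast
  define orb where "orb = (\<lambda>i n. (g ^^ n) (s i))"
  have orb_0: "orb i 0 = s i" and orb_Suc: "orb i (Suc n) = g (orb i n)" for i n
    unfolding orb_def by simp_all
  define M where "M = V - X - {v}"
  \<comment> \<open>Where two orbits meet, injectivity of \<open>g\<close> on \<open>M\<close> lets
    both be traced back until one is at its start. By \<open>sg\<close> no start is a value of
    \<open>g\<close> on \<open>M\<close>, so both are at their starts, which differ for different
    indices. The case \<open>i = j\<close> excludes repetitions.\<close>
  have inj_orb: "i = j \<and> a = b"
    if "i < K" "j < K" "\<forall>n<a. orb i n \<in> M" "\<forall>n<b. orb j n \<in> M" "orb i a = orb j b" for i j a b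
    using that
  proof (induction a arbitrary: b)
    case 0
    show ?case
    proof (cases b)
      case 0
      with \<open>orb i 0 = orb j b\<close> \<open>i < K\<close> \<open>j < K\<close> inj_s show ?thesis by (auto simp: orb_0 inj_on_def)
    next
      case (Suc b')
      with 0 sg[of i "orb j b'"] show ?thesis by (auto simp: orb_0 orb_Suc M_def)
    qed
  next
    case (Suc a)
    show ?case
    proof (cases b)
      case 0
      with Suc.prems sg[of j "orb i a"] show ?thesis by (auto simp: orb_0 orb_Suc M_def)
    next
      case (Suc b')
      with Suc.prems have "orb i a = orb j b'"
        using inj_g unfolding M_def[symmetric] by (auto simp: orb_Suc inj_on_def)
      with Suc Suc.IH[of b'] Suc.prems show ?thesis by auto
    qed
  qed
  have orb_V: "orb i a \<in> V - {v}" if "i < K" "\<forall>n<a. orb i n \<in> M" for i a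
    using that s_V g_V by (cases a) (auto simp: orb_0 orb_Suc M_def)
  have "\<exists>n. orb i n \<notin> M" if "i < K" for i
  proof (rule ccontr)
    assume "\<nexists>n. orb i n \<notin> M"
    then have *: "orb i n \<in> M" for n by blast
    then have "inj (orb i)" using inj_orb[OF that that] by (auto simp: inj_def)
    moreover have "finite (range (orb i))"
      using * assms(1) unfolding M_def by (meson finite_Diff finite_subset image_subsetI)
    ultimately show False using finite_imageD by blast
  qed
  then have "\<exists>n. orb i n \<notin> M \<and> (\<forall>m<n. orb i m \<in> M)" if "i < K" for i
    using that exists_least_iff[of "\<lambda>n. orb i n \<notin> M"] by blast
  then obtain N where N: "\<And>i. i < K \<Longrightarrow> orb i (N i) \<notin> M" "\<And>i m. i < K \<Longrightarrow> m < N i \<Longrightarrow> orb i m \<in> M"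
    by metis
  \<comment> \<open>\<open>N i\<close> is the first exit from \<open>M\<close>. The orbit is still
    in \<open>V - {v}\<close> there, so it exits into \<open>X\<close>.\<close>
  have N_X: "orb i (N i) \<in> X" if "i < K" for i
    using orb_V[OF that, of "N i"] N that unfolding M_def by blast
  define p where "p = (\<lambda>i. map (orb i) [0..<Suc (N i)])"
  have set_p: "set (p i) = orb i ` {..N i}" for i
    unfolding p_def by (auto simp: image_iff le_less)
  show thesis
  proof
    fix i assume i: "i < K"
    have ne: "p i \<noteq> []" unfolding p_def by simp
    have last: "last (p i) = orb i (N i)" unfolding p_def by simp
    have hd: "hd (p i) = s i" unfolding p_def by (simp add: hd_map orb_0 del: upt_Suc)
    have dist: "distinct (p i)"
      unfolding p_def distinct_map inj_on_def using inj_orb[OF i i] N i by auto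
    have suc: "(orb i n, orb i (Suc n)) \<in> E" if "n < N i" for n
    proof -
      \<comment> \<open>A fixed point of \<open>g\<close> would be a repetition on the orbit, so
        here \<open>g\<close> moves along an edge.\<close>
      have "orb i n \<noteq> orb i (Suc n)" using inj_orb[OF i i, of n "Suc n"] N(2)[OF i] that by fastforce
      then show ?thesis using g[of "orb i n"] N(2)[OF i that] by (auto simp: orb_Suc M_def)
    qed
    have "successively (\<lambda>x y. (x, y) \<in> E) (p i)"
      unfolding p_def by (auto simp: successively_conv_nth suc simp del: upt_Suc)
    moreover have "v \<notin> set (p i)" 
    proof
      assume "v \<in> set (p i)"
      then obtain n where "n \<le> N i" "orb i n = v" unfolding set_p by auto
      then show False using orb_V[OF i, of n] N(2)[OF i] by auto
    qed
    moreover have "set (p i) \<inter> X = {last (p i)}"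
    proof -
      have "n = N i" if "n \<le> N i" "orb i n \<in> X" for n
        using N(2)[OF i, of n] that unfolding M_def by fastforce
      then show ?thesis using N_X[OF i] unfolding set_p last by blast
    qed
    ultimately show "p i \<noteq> [] \<and> simple_path E (v # p i) \<and> set (p i) \<inter> X = {last (p i)}"
      using ne dist vs[OF i] hd by (auto simp: simple_path_def successively_Cons)
  next
    fix i j assume "i < K" "j < K" "i \<noteq> j"
    then show "set (p i) \<inter> set (p j) = {}"
      unfolding set_p using inj_orb[of i j] N(2) by fastforce
  qed
qed

section \<open>Paths through prescribed vertices\<close>

lemma simple_path_rev:
  assumes "sym E" shows "simple_path E (rev p) \<longleftrightarrow> simple_path E p"
  using assms unfolding simple_path_def by (auto simp: sym_def elim!: successively_mono)

lemma simple_path_append: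
  "simple_path E (p @ q) \<longleftrightarrow> simple_path E p \<and> simple_path E q \<and> set p \<inter> set q = {}
    \<and> (p \<noteq> [] \<longrightarrow> q \<noteq> [] \<longrightarrow> (last p, hd q) \<in> E)"
  unfolding simple_path_def successively_append_iff by auto

text \<open>The tail \<open>P2\<close> is given up: after \<open>P1\<close> the fan path is
  traversed backwards from \<open>x\<close> to \<open>v\<close>.\<close>

lemma simple_path_insert_at_end:
  assumes "sym E" "simple_path E (P1 @ x # P2)" "simple_path E (v # p)" "p \<noteq> []"
    and "set p \<inter> set (P1 @ x # P2) = {last p}" "last p = x" "v \<notin> set (P1 @ x # P2)"
  shows "simple_path E (P1 @ rev (v # p))"
proof -
  have "x \<notin> set P1" using assms(2) by (auto simp: simple_path_def)
  then show ?thesis using assms simple_path_rev[OF assms(1), of "v # p"]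
    unfolding simple_path_append by (auto simp: hd_rev)
qed

text \<open>The stretch \<open>P2\<close> is replaced by a detour from \<open>x\<close> through
  \<open>v\<close> to \<open>y\<close>. At most vertices of \<open>P2\<close> are lost, since
  \<open>x\<close> and \<open>y\<close> are the ends of \<open>p\<close> and
  \<open>q\<close>.\<close>

lemma simple_path_reroute:
  assumes "sym E" "simple_path E (P1 @ x # P2 @ y # P3)" "x \<noteq> y"
    and "v \<notin> set (P1 @ x # P2 @ y # P3)"
    and "simple_path E (v # p)" "p \<noteq> []" "set p \<inter> set (P1 @ x # P2 @ y # P3) = {last p}" "last p = x"
    and "simple_path E (v # q)" "q \<noteq> []" "set q \<inter> set (P1 @ x # P2 @ y # P3) = {last q}" "last q = y"
    and "set p \<inter> set q = {}"
  shows "simple_path E (P1 @ rev p @ v # q @ P3)"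
proof -
  have d: "x \<notin> set P1" "x \<notin> set P3" "y \<notin> set P1" "y \<notin> set P3" "set P1 \<inter> set P3 = {}"
    using assms(2) by (auto simp: simple_path_def)
  have 1: "simple_path E (P1 @ rev (v # p))"
    using assms by (intro simple_path_insert_at_end[of _ _ x "P2 @ y # P3"]) auto
  have "simple_path E (P1 @ x # P2 @ y # P3) \<Longrightarrow> simple_path E (y # P3)"
    unfolding simple_path_def by (auto simp: successively_append_iff successively_Cons)
  then have y: "simple_path E (y # P3)" using assms by blast
  have "simple_path E (q @ P3)"
    using assms y d unfolding simple_path_def
    by (auto simp: successively_append_iff successively_Cons)
  moreover have "(v, hd q) \<in> E" "v \<notin> set q" using assms by (auto simp: simple_path_def successively_Cons)
  moreover have "set (P1 @ rev (v # p)) \<inter> set (q @ P3) = {}"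
    using assms d \<open>v \<notin> set q\<close> by auto
  ultimately have "simple_path E ((P1 @ rev (v # p)) @ (q @ P3))"
    using 1 assms(10) \<open>(v, hd q) \<in> E\<close> unfolding simple_path_append[of _ "P1 @ rev (v # p)"] by simp
  then show ?thesis by simp
qed

text \<open>Only \<open>B\<close>, not all of \<open>P\<close>, has to survive, so part of
  \<open>P\<close> may be sacrificed to make room for \<open>v\<close>: a tail, or a stretch between
  two ends of a fan from \<open>v\<close>.\<close>

lemma path_insert_vertex:
  assumes "finite V" "E \<subseteq> V \<times> V" "irrefl E" "sym E" "k_connected V E k"
    and P: "simple_path E P" "set P \<subseteq> V" and "B \<subseteq> set P" "card B < k" "v \<in> V"
  shows "\<exists>Q. simple_path E Q \<and> set Q \<subseteq> V \<and> insert v B \<subseteq> set Q"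
proof -
  consider "P = []" | "v \<in> set P" | "P \<noteq> []" "v \<notin> set P" by blast
  then show ?thesis
  proof cases
    case 1
    with assms show ?thesis by (intro exI[of _ "[v]"]) (auto simp: simple_path_def)
  next
    case 2
    with assms show ?thesis by blast
  next
    case 3
    \<comment> \<open>A fan has no more ends on \<open>P\<close> than \<open>P\<close> has vertices,
      so a short \<open>P\<close> may not admit \<open>k\<close> of them.\<close>
    define K where "K = min k (card (set P))"
    obtain p where p: "\<And>i. i < K \<Longrightarrow> p i \<noteq> [] \<and> simple_path E (v # p i) \<and> set (p i) \<inter> set P = {last (p i)}"
      "\<And>i j. i < K \<Longrightarrow> j < K \<Longrightarrow> i \<noteq> j \<Longrightarrow> set (p i) \<inter> set (p j) = {}"
      using fan[OF assms(1,2,3,5,10) P(2) 3(2), of K] unfolding K_def by auto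
    \<comment> \<open>\<open>fan\<close> does not place its paths in \<open>V\<close>, but each
      vertex of \<open>p i\<close> is the head of an arc from its predecessor on
      \<open>v # p i\<close>.\<close>
    have in_V: "set (p i) \<subseteq> V" if "i < K" for i
    proof
      fix y assume "y \<in> set (p i)"
      then obtain as bs where "p i = as @ y # bs" by (meson split_list)
      then have "(last (v # as), y) \<in> E"
        using p(1)[OF that] simple_path_append[of E "v # as" "y # bs"] by simp
      then show "y \<in> V" using assms(2) by blast
    qed
    have dP: "distinct P" using P by (simp add: simple_path_def)
    have "\<exists>n<length P. P ! n = last (p i)" if "i < K" for i
      using p(1)[OF that] by (metis IntD2 in_set_conv_nth insertI1)
    then obtain e where e: "\<And>i. i < K \<Longrightarrow> e i < length P" "\<And>i. i < K \<Longrightarrow> P ! e i = last (p i)"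
      by metis
    have inj_e: "inj_on e {..<K}"
    proof (rule inj_onI)
      fix i j assume ij: "i \<in> {..<K}" "j \<in> {..<K}" "e i = e j"
      then have "last (p i) = last (p j)" using e by (metis lessThan_iff)
      then show "i = j" using p ij by (metis disjoint_iff last_in_set lessThan_iff)
    qed
    \<comment> \<open>Either some end of the fan has all of \<open>B\<close> weakly before it, or two ends have the same
      vertices of \<open>B\<close> before them, and then rerouting through \<open>v\<close> loses nothing of \<open>B\<close>.\<close>
    define C where "C = (\<lambda>n. B \<inter> set (take (Suc n) P))"
    have finB: "finite B" using assms(8) finite_subset by blast
    have split: "P = take n P @ P ! n # drop (Suc n) P" if "n < length P" for n
      using that by (simp add: id_take_nth_drop)
    show ?thesis
    proof (cases "\<exists>i<K. C (e i) = B")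
      case True
      then obtain i where i: "i < K" "C (e i) = B" by blast
      note s = split[OF e(1)[OF i(1)]]
      have "simple_path E (take (e i) P @ rev (v # p i))"
      proof (rule simple_path_insert_at_end[OF assms(4)])
        show "simple_path E (take (e i) P @ P ! e i # drop (Suc (e i)) P)"
          using P(1) s by metis
        show "simple_path E (v # p i)" "p i \<noteq> []" "last (p i) = P ! e i"
          using p(1)[OF i(1)] e(2)[OF i(1)] by simp_all
        show "set (p i) \<inter> set (take (e i) P @ P ! e i # drop (Suc (e i)) P) = {last (p i)}"
          using p(1)[OF i(1)] s by metis
        show "v \<notin> set (take (e i) P @ P ! e i # drop (Suc (e i)) P)"
          using 3(2) s by metis
      qed
      moreover have "insert v B \<subseteq> set (take (e i) P @ rev (v # p i))"
      proof -
        have "set (take (Suc (e i)) P) \<subseteq> set (take (e i) P) \<union> {last (p i)}"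
          using e[OF i(1)] by (auto simp: take_Suc_conv_app_nth)
        then show ?thesis using i p(1)[OF i(1)] unfolding C_def by auto
      qed
      moreover have "set (take (e i) P @ rev (v # p i)) \<subseteq> V"
        using in_V[OF i(1)] assms(10) P(2) by (auto dest: in_set_takeD)
      ultimately show ?thesis by blast
    next
      case False
      \<comment> \<open>If \<open>K < k\<close>, every vertex of \<open>P\<close> is an end of the
        fan, in particular the last one, which has all of \<open>B\<close> weakly before it.\<close>
      have K: "K = k"
      proof (rule ccontr)
        assume "K \<noteq> k"
        then have "card (e ` {..<K}) = card {..<length P}"
          using dP inj_e by (simp add: card_image K_def distinct_card split: if_splits)
        moreover have "e ` {..<K} \<subseteq> {..<length P}" using e(1) by auto
        ultimately have "e ` {..<K} = {..<length P}" by (simp add: card_subset_eq)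
        then obtain i where "i < K" "e i = length P - 1"
          using 3 by (metis diff_less image_iff length_greater_0_conv lessThan_iff zero_less_one)
        moreover from this have "C (e i) = B" using assms(8) unfolding C_def by auto
        ultimately show False using False by blast
      qed
      \<comment> \<open>No \<open>C (e i)\<close> is all of \<open>B\<close>, so the counts take at
        most \<open>card B\<close> values, while there are \<open>k > card B\<close> ends.\<close>
      have "card (C (e i)) < card B" if "i < K" for i
        using False that finB unfolding C_def by (intro psubset_card_mono) auto
      then have "(\<lambda>i. card (C (e i))) ` {..<K} \<subseteq> {..<card B}" by auto
      then have "card ((\<lambda>i. card (C (e i))) ` {..<K}) \<le> card B"
        using subset_eq_atLeast0_lessThan_card by (simp add: lessThan_atLeast0)
      then have "card ((\<lambda>i. card (C (e i))) ` {..<K}) < card {..<K}"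
        using assms(9) K by simp
      then have "\<not> inj_on (\<lambda>i. card (C (e i))) {..<K}" by (rule pigeonhole)
      then obtain i j where ij: "i < K" "j < K" "i \<noteq> j" "card (C (e i)) = card (C (e j))"
        unfolding inj_on_def by auto
      obtain i j where ij: "i < K" "j < K" "e i < e j" "card (C (e i)) = card (C (e j))"
      proof (cases "e i < e j")
        case False
        then have "e j < e i" using inj_e ij by (metis inj_on_def lessThan_iff linorder_neqE_nat)
        then show thesis using ij that by metis
      qed (use ij that in blast)
      \<comment> \<open>The prefixes are nested, so equal counts mean equal sets: no vertex of
        \<open>B\<close> lies behind \<open>x\<close> up to and including \<open>y\<close>.\<close>
      have "C (e i) \<subseteq> C (e j)"
        unfolding C_def using ij set_take_subset_set_take[of "Suc (e i)" "Suc (e j)" P] by auto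
      then have CC: "C (e i) = C (e j)"
        using ij finB unfolding C_def by (intro card_subset_eq) auto
      define P1 x P2 y P3 where "P1 = take (e i) P" and "x = P ! e i"
        and "P2 = drop (Suc (e i)) (take (e j) P)" and "y = P ! e j" and "P3 = drop (Suc (e j)) P"
      have "e i < length (take (e j) P)" using ij(3) e(1)[OF ij(2)] by simp
      from id_take_nth_drop[OF this] have tk: "take (e j) P = P1 @ x # P2"
        using ij(3) unfolding P1_def P2_def x_def by (metis min.absorb1 less_imp_le nth_take take_take)
      have PP: "P = P1 @ x # P2 @ y # P3"
        using split[OF e(1)[OF ij(2)]] tk P3_def y_def by (metis append.assoc append_Cons)
      have "take (Suc (e i)) P = P1 @ [x]" "take (Suc (e j)) P = P1 @ x # P2 @ [y]"
        using tk e(1) ij unfolding P1_def x_def y_def by (auto simp: take_Suc_conv_app_nth)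
      moreover have "distinct (P1 @ x # P2 @ y # P3)" using dP PP by simp
      ultimately have B: "B \<inter> set (P2 @ [y]) = {}"
        using CC unfolding C_def by auto
      have "simple_path E (P1 @ rev (p i) @ v # p j @ P3)"
      proof (rule simple_path_reroute[OF assms(4)])
        show "simple_path E (P1 @ x # P2 @ y # P3)" "v \<notin> set (P1 @ x # P2 @ y # P3)"
          using P(1) 3(2) PP by simp_all
        show "x \<noteq> y" using dP PP by auto
        show "simple_path E (v # p i)" "p i \<noteq> []" "simple_path E (v # p j)" "p j \<noteq> []"
          using p(1) ij(1,2) by simp_all
        show "last (p i) = x" "last (p j) = y"
          using e(2) ij(1,2) unfolding x_def y_def by simp_all
        show "set (p i) \<inter> set (P1 @ x # P2 @ y # P3) = {last (p i)}"
          "set (p j) \<inter> set (P1 @ x # P2 @ y # P3) = {last (p j)}"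
          using p(1) ij(1,2) PP by metis+
        show "set (p i) \<inter> set (p j) = {}" using p(2) ij(1-3) by (metis less_irrefl)
      qed
      moreover have "insert v B \<subseteq> set (P1 @ rev (p i) @ v # p j @ P3)"
      proof -
        have "x \<in> set (p i)" using p(1)[OF ij(1)] e(2)[OF ij(1)] x_def by (metis last_in_set)
        moreover have "B \<subseteq> set P1 \<union> {x} \<union> set (P2 @ [y]) \<union> set P3"
          using assms(8) PP by auto
        ultimately show ?thesis using B by auto
      qed
      moreover have "set (P1 @ rev (p i) @ v # p j @ P3) \<subseteq> V"
      proof -
        have "set P1 \<union> set P3 \<subseteq> V" using P(2) PP by auto
        then show ?thesis using in_V[OF ij(1)] in_V[OF ij(2)] assms(10) by auto
      qed
      ultimately show ?thesis by blast
    qed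
  qed
qed

lemma path_through:
  assumes "finite V" "E \<subseteq> V \<times> V" "irrefl E" "sym E" "k_connected V E k" "B \<subseteq> V" "card B \<le> k"
  shows "\<exists>P. simple_path E P \<and> set P \<subseteq> V \<and> B \<subseteq> set P"
proof -
  have "finite B" using assms finite_subset by blast
  then show ?thesis using assms(6,7)
  proof (induction B)
    case empty
    show ?case by (intro exI[of _ "[]"]) (simp add: simple_path_def)
  next
    case (insert v B)
    then obtain P where "simple_path E P" "set P \<subseteq> V" "B \<subseteq> set P" by auto
    then show ?case using path_insert_vertex[OF assms(1-5), of P B v] insert by auto
  qed
qed

section \<open>Spanning trees\<close>

text \<open>This form of a tree yields connectedness and acyclicity by rule induction, and makes the
  extension of a path to a spanning tree a repeated use of \<open>leaf\<close>.\<close>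

inductive grown_tree :: "'a set \<Rightarrow> 'a rel \<Rightarrow> bool" where
  root: "grown_tree {r} {}"
| leaf: "grown_tree W A \<Longrightarrow> u \<in> W \<Longrightarrow> w \<notin> W \<Longrightarrow> grown_tree (insert w W) ({(u, w), (w, u)} \<union> A)"

lemma grown_tree_basic:
  assumes "grown_tree W A"
  shows "finite W" "finite A" "sym A" "irrefl A" "A \<subseteq> W \<times> W" "W \<noteq> {}"
  using assms by (induction, auto simp: sym_def irrefl_def)

lemma grown_tree_reachable:
  assumes "grown_tree W A" "x \<in> W" "y \<in> W"
  shows "(x, y) \<in> rtrancl_on W A"
  using assms
proof (induction arbitrary: x y)
  case (leaf W A u w)
  let ?R = "rtrancl_on (insert w W) ({(u, w), (w, u)} \<union> A)"
  have old: "(x, y) \<in> ?R" if "x \<in> W" "y \<in> W" for x y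
    using rtrancl_on_mono[OF _ _ leaf.IH[OF that]] by blast
  have uw: "(u, w) \<in> ?R" "(w, u) \<in> ?R"
    using leaf.hyps by (blast intro: rtrancl_on_into_rtrancl_on)+
  have "(x, u) \<in> ?R" "(u, y) \<in> ?R"
    using leaf.prems leaf.hyps uw old by auto
  then show ?case by (rule rtrancl_on_trans)
qed auto

text \<open>The leaf \<open>w\<close> added last lies on no cycle: both its cyclic neighbours would
  be \<open>u\<close>, so the positions before and after it would agree, which is impossible for
  \<open>n \<ge> 3\<close>. A cycle avoiding \<open>w\<close> lies in the smaller tree.\<close>

lemma grown_tree_no_cycle:
  assumes "grown_tree W A" "3 \<le> n" "inj_on c {..<n}"
    and "\<And>i. i < n \<Longrightarrow> (c i, c (Suc i mod n)) \<in> A"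
  shows False
  using assms
proof (induction)
  case (root r)
  then show ?case by (metis empty_iff not_numeral_le_zero not_gr_zero)
next
  case (leaf W A u w)
  have A: "A \<subseteq> W \<times> W" using grown_tree_basic[OF leaf.hyps(1)] by simp
  show ?case
  proof (cases "\<exists>i<n. c i = w")
    case True
    then obtain i where i: "i < n" "c i = w" by blast
    define j where "j = (if i = 0 then n - 1 else i - 1)"
    have j: "j < n" "Suc j mod n = i" using i leaf.prems unfolding j_def by auto
    have "c (Suc i mod n) = u" using leaf.prems(3)[OF i(1)] i A leaf.hyps by auto
    moreover have "c j = u" using leaf.prems(3)[OF j(1)] i A leaf.hyps unfolding j(2) by auto
    ultimately have "Suc i mod n = j"
      using leaf.prems(1,2) j(1) by (auto simp: inj_on_def)
    then show False using j i leaf.prems(1) by (auto simp: mod_Suc split: if_splits)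
  next
    case False
    have "(c i, c (Suc i mod n)) \<in> A" if "i < n" for i
    proof -
      have "Suc i mod n < n" using that by simp
      then have "c i \<noteq> w" "c (Suc i mod n) \<noteq> w" using False that by blast+
      then show ?thesis using leaf.prems(3)[OF that] by auto
    qed
    then show False using leaf.IH leaf.prems by blast
  qed
qed

text \<open>Indexed access to a walk, used to turn a closed arc list into the cyclic vertex sequence
  that \<open>grown_tree_no_cycle\<close> expects.\<close>

lemma pcas_closed_arcs:
  assumes "pcas u p v"
  shows "pawalk_verts u p = u # map snd p"
    and "i < length p \<Longrightarrow> fst (p ! i) = (if i = 0 then u else snd (p ! (i - 1)))"
    and "p \<noteq> [] \<Longrightarrow> snd (last p) = v"
  using assms
proof (induction p arbitrary: u i)
  case (Cons e es)
  { case 1 with Cons.IH(1)[of "snd e"] show ?case by simp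
  next
    case 2 with Cons.IH(2)[of "i - 1" "snd e"] show ?case by (cases i) (auto simp: nth_Cons')
  next
    case 3 with Cons.IH(3)[of "snd e"] show ?case by (cases es) auto }
qed auto

lemma undirected_tree_grown_tree:
  assumes "grown_tree W A"
  shows "undirected_tree \<lparr>pverts = W, parcs = A\<rparr>"
proof -
  let ?T = "\<lparr>pverts = W, parcs = A\<rparr>"
  note b = grown_tree_basic[OF assms]
  interpret pair_graph ?T
    using b by unfold_locales (auto simp: irrefl_def symmetric_def)
  \<comment> \<open>\<open>connected\<close> refers to the symmetric closure, which adds no arcs
    here.\<close>
  have "parcs (mk_symmetric (with_proj ?T)) = A"
    using adj_mk_symmetric_eq[OF sym_arcs] by simp
  then have "connected (with_proj ?T)"
    unfolding connected_def strongly_connected_def reachable_def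
    using b(6) grown_tree_reachable[OF assms] by simp
  moreover have False if p: "cycle p" "3 \<le> length p" for p
  proof -
    obtain u where u: "u \<in> W" "set p \<subseteq> A" "pcas u p u" "distinct (map snd p)" "p \<noteq> []"
      using p(1) unfolding cycle_def awalk_def by (auto simp: pcas_closed_arcs(1))
    \<comment> \<open>The cycle is read as the sequence of its heads; the arc from head
      \<open>i\<close> to the next head is the arc of \<open>p\<close> at the next index modulo the
      length.\<close>
    have "(snd (p ! i), snd (p ! (Suc i mod length p))) \<in> A" if i: "i < length p" for i
    proof -
      let ?j = "Suc i mod length p"
      have j: "?j < length p" using u(5) by (intro mod_less_divisor) simp
      have "fst (p ! ?j) = snd (p ! i)"
      proof (cases "Suc i = length p")
        case True
        then have "p ! i = last p" using u(5) by (simp add: last_conv_nth flip: True)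
        then show ?thesis
          using pcas_closed_arcs(2)[OF u(3) j] pcas_closed_arcs(3)[OF u(3,5)] True by simp
      next
        case False
        then show ?thesis using pcas_closed_arcs(2)[OF u(3) j] i by simp
      qed
      then show ?thesis using nth_mem[OF j] u(2) by (metis prod.collapse subsetD)
    qed
    moreover have "inj_on (\<lambda>i. snd (p ! i)) {..<length p}"
      using u(4) by (auto simp: distinct_conv_nth inj_on_def)
    ultimately show False using grown_tree_no_cycle[OF assms p(2)] by blast
  qed
  ultimately show ?thesis unfolding undirected_tree_def by blast
qed

text \<open>The tree grows from the last vertex of \<open>p\<close> backwards, each earlier vertex
  being a leaf attached to its successor.\<close>

lemma grown_tree_path:
  assumes "distinct p" "p \<noteq> []"
  shows "grown_tree (set p) (set (vwalk_arcs p) \<union> (set (vwalk_arcs p))\<inverse>)"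
  using assms
proof (induction p rule: vwalk_arcs.induct)
  case (3 x y xs)
  then have "grown_tree (insert x (set (y # xs)))
    ({(y, x), (x, y)} \<union> (set (vwalk_arcs (y # xs)) \<union> (set (vwalk_arcs (y # xs)))\<inverse>))"
    by (intro grown_tree.leaf) auto
  moreover have "{(y, x), (x, y)} \<union> (set (vwalk_arcs (y # xs)) \<union> (set (vwalk_arcs (y # xs)))\<inverse>)
     = set (vwalk_arcs (x # y # xs)) \<union> (set (vwalk_arcs (x # y # xs)))\<inverse>" by auto
  ultimately show ?case by (metis list.simps(15))
qed (auto intro: grown_tree.root)

text \<open>Connectedness of \<open>E\<close> enters as the cut condition, which supplies an edge
  leaving \<open>W\<close> as long as \<open>W\<close> is not all of \<open>V\<close>.\<close>

lemma grown_tree_extend: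
  assumes "finite V" "sym E"
    and cut: "\<And>W. W \<subset> V \<Longrightarrow> W \<noteq> {} \<Longrightarrow> \<exists>u\<in>W. \<exists>v\<in>V - W. (u, v) \<in> E"
    and "grown_tree W A" "W \<subseteq> V" "A \<subseteq> E"
  obtains A' where "A \<subseteq> A'" "A' \<subseteq> E" "grown_tree V A'"
proof -
  have "\<exists>A'. A \<subseteq> A' \<and> A' \<subseteq> E \<and> grown_tree V A'"
    using assms(4-6)
  proof (induction "card (V - W)" arbitrary: W A rule: less_induct)
    case less
    show ?case
    proof (cases "W = V")
      case True
      then show ?thesis using less.prems by auto
    next
      case False
      then obtain u w where uw: "u \<in> W" "w \<in> V - W" "(u, w) \<in> E"
        using cut[of W] less.prems grown_tree_basic(6) by blast
      have "card (V - insert w W) < card (V - W)"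
        using uw assms(1) by (intro psubset_card_mono) auto
      moreover have "grown_tree (insert w W) ({(u, w), (w, u)} \<union> A)"
        using less.prems uw by (intro grown_tree.leaf) auto
      moreover have "insert w W \<subseteq> V" "{(u, w), (w, u)} \<union> A \<subseteq> E"
        using less.prems uw assms(2) by (auto dest: symD)
      ultimately obtain A' where "{(u, w), (w, u)} \<union> A \<subseteq> A'" "A' \<subseteq> E" "grown_tree V A'"
        using less.hyps[of "insert w W" "{(u, w), (w, u)} \<union> A"] by blast
      then show ?thesis by (intro exI[of _ A']) auto
    qed
  qed
  then show thesis using that by blast
qed

section \<open>Connectivity through cuts, and the spanning caterpillar\<close>

lemma connected_cut:
  assumes "sym (arcs_ends D)" "connected D" "W \<subset> verts D" "W \<noteq> {}"
  shows "\<exists>u\<in>W. \<exists>v\<in>verts D - W. (u, v) \<in> arcs_ends D"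
proof (rule ccontr)
  assume *: "\<not> ?thesis"
  obtain x y where xy: "x \<in> W" "y \<in> verts D - W" using assms by blast
  have "parcs (mk_symmetric D) = arcs_ends D"
    using assms(1) by (auto simp: parcs_mk_symmetric arcs_ends_conv dest: symD)
  then have "(x, y) \<in> rtrancl_on (verts D) (arcs_ends D)"
    using assms xy unfolding connected_def strongly_connected_def reachable_def by auto
  then have "y \<in> W"
    by (induction rule: rtrancl_on_induct) (use xy * in auto)
  then show False using xy by blast
qed

text \<open>Deleting the neighbours of \<open>W\<close> outside \<open>W\<close> cuts
  \<open>W\<close> off from the vertices that are neither in \<open>W\<close> nor adjacent to it.
  When there are such vertices, the deleted set is a candidate in the minimum that defines the
  connectivity.\<close>

lemma k_connected_vertex_connectivity:
  assumes "pair_graph G"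
  shows "k_connected (pverts G) (parcs G) (vertex_connectivity G)"
proof -
  interpret pair_graph G by fact
  have sym: "sym (parcs G)" using pair_sym_arcs by (simp add: symmetric_def)
  show ?thesis
    unfolding k_connected_def
  proof (intro allI impI)
    fix W assume W: "W \<subseteq> pverts G" "W \<noteq> {}" "W \<union> parcs G `` W \<noteq> pverts G"
    define S where "S = parcs G `` W - W"
    have S: "S \<subset> pverts G" using W unfolding S_def by (auto dest: in_arcsD2)
    \<comment> \<open>In a complete graph a nonempty \<open>W\<close> and its neighbours already
      make up all vertices.\<close>
    have "\<not> complete_graph G"
    proof
      assume "complete_graph G"
      moreover obtain w where "w \<in> W" "w \<in> pverts G" using W(1,2) by blast
      ultimately have "y \<in> W \<union> parcs G `` W" if "y \<in> pverts G" for y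
        using that unfolding complete_graph_def by (cases "y = w") (simp, metis ImageI UnI2)
      then have "pverts G \<subseteq> W \<union> parcs G `` W" by blast
      then show False using W by (auto dest: in_arcsD2)
    qed
    then have vc: "vertex_connectivity G = (LEAST k. \<exists>S. S \<subset> pverts G \<and>
        \<not> connected (with_proj G \<restriction> (pverts G - S)) \<and> k = card S)"
      unfolding vertex_connectivity_def by simp
    have "\<not> connected (with_proj G \<restriction> (pverts G - S))"
    proof
      let ?D = "with_proj G \<restriction> (pverts G - S)"
      assume c: "connected ?D"
      have ends: "arcs_ends ?D = {e \<in> parcs G. fst e \<in> pverts G - S \<and> snd e \<in> pverts G - S}"
        by (simp add: arcs_ends_conv)
      have "sym (arcs_ends ?D)" using sym unfolding ends by (auto simp: sym_def)
      moreover have "W \<subset> verts ?D" using W unfolding S_def by (auto dest: in_arcsD2)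
      ultimately obtain u v where uv: "u \<in> W" "v \<in> verts ?D - W" "(u, v) \<in> arcs_ends ?D"
        using connected_cut[OF _ c _ W(2)] by blast
      then have "(u, v) \<in> parcs G" "v \<notin> S" unfolding ends by auto
      then show False using uv(1,2) unfolding S_def by blast
    qed
    then show "vertex_connectivity G \<le> card (parcs G `` W - W)"
      unfolding vc S_def[symmetric] using S by (intro Least_le) blast
  qed
qed

text \<open>\<open>E\<close> is a parameter because two choices are made: all arcs of
  \<open>G\<close>, to get some spanning tree, and the union of an optimal tree and a path.\<close>

lemma spanning_tree_extends_path:
  assumes "pair_graph G" "sym E" "E \<subseteq> parcs G"
    and cut: "\<And>W. W \<subset> pverts G \<Longrightarrow> W \<noteq> {} \<Longrightarrow> \<exists>u\<in>W. \<exists>v\<in>pverts G - W. (u, v) \<in> E"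
    and P: "distinct P" "P \<noteq> []" "set P \<subseteq> pverts G" "set (vwalk_arcs P) \<subseteq> E"
  obtains T where "undirected_spanning_tree T G" "vpath P (with_proj T)" "parcs T \<subseteq> E"
proof -
  interpret pair_graph G by fact
  have "set (vwalk_arcs P) \<union> (set (vwalk_arcs P))\<inverse> \<subseteq> E"
    using P(4) assms(2) by (auto dest: symD)
  then obtain A where A: "set (vwalk_arcs P) \<union> (set (vwalk_arcs P))\<inverse> \<subseteq> A" "A \<subseteq> E"
    "grown_tree (pverts G) A"
    using grown_tree_extend[OF pair_finite_verts assms(2) cut grown_tree_path[OF P(1,2)] P(3)]
    by blast
  let ?T = "\<lparr>pverts = pverts G, parcs = A\<rparr>"
  have t: "undirected_tree ?T" by (rule undirected_tree_grown_tree[OF A(3)])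
  then interpret T: pair_graph ?T by (simp add: undirected_tree_def)
  have "spanning (with_proj ?T) (with_proj G)"
    using A(2) assms(3) T.wf_digraph_axioms wf_digraph_axioms unfolding spanning_def subgraph_def
    by auto
  with t have "undirected_spanning_tree ?T G" unfolding undirected_spanning_tree_def by blast
  moreover have "vpath P (with_proj ?T)"
    unfolding vpath_def vwalk_def using P A(1) by auto
  ultimately show thesis using that A(2) by force
qed

lemma successively_iff_vwalk_arcs:
  "successively (\<lambda>x y. (x, y) \<in> E) p \<longleftrightarrow> set (vwalk_arcs p) \<subseteq> E"
  by (induction p rule: vwalk_arcs.induct) auto

text \<open>New arcs have both ends in \<open>X\<close>, so no vertex outside \<open>X\<close> gains
  degree.\<close>

lemma branch_vertices_subset_path:
  assumes "pair_graph T" "pverts T' = pverts T" "parcs T' \<subseteq> parcs T \<union> X \<times> X" "branch_vertices T \<subseteq> X"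
  shows "branch_vertices T' \<subseteq> X"
proof
  interpret pair_graph T by fact
  fix v assume v: "v \<in> branch_vertices T'"
  show "v \<in> X"
  proof (rule ccontr)
    assume "v \<notin> X"
    then have "out_arcs (with_proj T') v \<subseteq> out_arcs (with_proj T) v"
      using assms(3) by (auto simp: out_arcs_def)
    moreover have "finite (out_arcs (with_proj T) v)"
      using pair_finite_arcs by (simp add: out_arcs_def)
    ultimately have "out_degree (with_proj T') v \<le> out_degree (with_proj T) v"
      unfolding out_degree_def by (intro card_mono)
    then have "v \<in> branch_vertices T" using v assms(2) unfolding branch_vertices_def by auto
    then show False using assms(4) \<open>v \<notin> X\<close> by blast
  qed
qed

theorem theorem1:
  fixes G :: "'a pair_pre_digraph"
  assumes "pair_graph G"
    and "connected (with_proj G)"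
    and "min_branch_vertices G \<le> vertex_connectivity G"
  shows "\<exists>T. spanning_generalized_caterpillar T G"
proof -
  interpret pair_graph G by fact
  have sym: "sym (parcs G)" using pair_sym_arcs by (simp add: symmetric_def)
  have irrefl: "irrefl (parcs G)" by (auto simp: irrefl_def dest: no_loops')
  obtain x where x: "x \<in> pverts G"
    using assms(2) unfolding connected_def strongly_connected_def by auto
  \<comment> \<open>The \<open>LEAST\<close> in \<open>min_branch_vertices\<close> is attained
    because some spanning tree exists; one is grown from a one-vertex path.\<close>
  have "\<exists>u\<in>W. \<exists>v\<in>pverts G - W. (u, v) \<in> parcs G" if "W \<subset> pverts G" "W \<noteq> {}" for W
    using connected_cut[of "with_proj G" W] assms(2) sym that by simp
  then obtain T0 where "undirected_spanning_tree T0 G"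
    by (rule spanning_tree_extends_path[OF assms(1) sym subset_refl, of "[x]"]) (use x in auto)
  then have "\<exists>n T. undirected_spanning_tree T G \<and> n = card (branch_vertices T)" by blast
  from LeastI_ex[OF this]
  obtain T where "undirected_spanning_tree T G" "min_branch_vertices G = card (branch_vertices T)"
    unfolding min_branch_vertices_def[symmetric] by blast
  then have T: "undirected_spanning_tree T G" "card (branch_vertices T) \<le> vertex_connectivity G"
    using assms(3) by simp_all
  interpret T: pair_graph T using T(1) by (simp add: undirected_spanning_tree_def undirected_tree_def)
  have pT: "pverts T = pverts G" "parcs T \<subseteq> parcs G" "connected (with_proj T)"
    using T(1) by (auto simp: undirected_spanning_tree_def undirected_tree_def spanning_def subgraph_def)
  have "branch_vertices T \<subseteq> pverts G" using pT by (auto simp: branch_vertices_def)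
  moreover have "parcs G \<subseteq> pverts G \<times> pverts G" by (auto dest: in_arcsD1 in_arcsD2)
  ultimately obtain P0 where P0: "simple_path (parcs G) P0" "set P0 \<subseteq> pverts G" "branch_vertices T \<subseteq> set P0"
    using path_through[OF pair_finite_verts _ irrefl sym k_connected_vertex_connectivity[OF assms(1)] _ T(2)]
    by blast
  \<comment> \<open>Without branch vertices \<open>P0\<close> may be empty, but \<open>vpath\<close>
    needs a nonempty list, so a single vertex takes its place.\<close>
  obtain P where P: "distinct P" "P \<noteq> []" "set P \<subseteq> pverts G" "set (vwalk_arcs P) \<subseteq> parcs G"
    "branch_vertices T \<subseteq> set P"
  proof (cases "P0 = []")
    case True
    with P0 x show thesis by (intro that[of "[x]"]) auto
  next
    case False
    with P0 show thesis
      by (intro that[of P0]) (auto simp: simple_path_def simp flip: successively_iff_vwalk_arcs)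
  qed
  \<comment> \<open>The new tree is sought inside \<open>E\<close>, which connects all vertices
    because \<open>T\<close> does and exceeds \<open>T\<close> only by arcs between vertices of
    \<open>P\<close>.\<close>
  define E where "E = parcs T \<union> (set (vwalk_arcs P) \<union> (set (vwalk_arcs P))\<inverse>)"
  have "sym (parcs T)" using T.pair_sym_arcs by (simp add: symmetric_def)
  then have "\<exists>u\<in>W. \<exists>v\<in>pverts G - W. (u, v) \<in> E" if "W \<subset> pverts G" "W \<noteq> {}" for W
    using connected_cut[of "with_proj T" W] that pT unfolding E_def by auto
  moreover have "sym E" "E \<subseteq> parcs G"
    using \<open>sym (parcs T)\<close> P(4) pT(2) sym unfolding E_def by (auto simp: sym_def)
  ultimately obtain T' where T': "undirected_spanning_tree T' G" "vpath P (with_proj T')" "parcs T' \<subseteq> E"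
    using spanning_tree_extends_path[OF assms(1) _ _ _ P(1-3), of E] unfolding E_def by blast
  have "E \<subseteq> parcs T \<union> set P \<times> set P"
    using grown_tree_basic(5)[OF grown_tree_path[OF P(1,2)]] unfolding E_def by blast
  moreover have "pverts T' = pverts T"
    using T'(1) pT(1) by (simp add: undirected_spanning_tree_def spanning_def)
  ultimately have "branch_vertices T' \<subseteq> set P"
    using branch_vertices_subset_path[OF T.pair_graph _ _ P(5)] T'(3) by blast
  then show ?thesis
    using T'(1,2) unfolding spanning_generalized_caterpillar_def generalized_caterpillar_def
      undirected_spanning_tree_def by blast
qed

end
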